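(* Let $c\ge1/4$, let $\mu,m\in(0,1)$ with $m\ne\mu$, and let $P=\mathrm{Bern}(\mu)$. When the observations are $X_i\sim\mathrm{Bern}(\mu)$, the ratio of $G(c,m,P)$ to the best achievable growth rate for testing the simple null hypothesis $\mathrm{Bern}(m)$ against the simple alternative $\mathrm{Bern}(\mu)$ is $$f(c,m,\mu)=\frac{\log\left(\left(1+\frac{(\mu-m)(1-m)}{c}\right)^{\mu}\left(1-\frac{(\mu-m)m}{c}\right)^{1-\mu}\right)}{\log\left(\left(\frac{\mu}{m}\right)^{\mu}\left(\frac{1-\mu}{1-m}\right)^{1-\mu}\right)}.$$
   Context: $\mathrm{Bern}(p)$ is the Bernoulli distribution with mean $p$. For a distribution $P$ on $[0,1]$ with mean $\mu$, the asymptotic growth rate is $G(c,m,P)=\mathbb{E}_{X\sim P}\left[\log\left(1+\frac{(\mu-m)(X-m)}{c}\right)\right]$. An $e$-value (based on one observation $X$) for the null hypothesis $\mathrm{Bern}(m)$ is a nonnegative function $E=E(X)$ with $\mathbb{E}_{X\sim\mathrm{Bern}(m)}[E(X)]\le1$; its growth rate ($e$-power) under the alternative $\mathrm{Bern}(\mu)$ is $\mathbb{E}_{X\sim\mathrm{Bern}(\mu)}[\log E(X)]$ (with $\log 0=-\infty$). The best achievable growth rate is the supremum of this quantity over all such $e$-values. *)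

theory Defs
  imports "HOL-Probability.Probability"
begin

definition Bern :: "real \<Rightarrow> real pmf" where
  "Bern p = map_pmf of_bool (bernoulli_pmf p)"

(* Only used on [0, \<infinity>); unlike ln on the reals, the value at 0 is -\<infinity>. *)
definition ext_ln :: "real \<Rightarrow> ereal" where
  "ext_ln y = (if y > 0 then ereal (ln y) else -\<infinity>)"

(* E[Z] = E[Z+] - E[Z-] for extended-real Z. The undefined case \<infinity> - \<infinity>
   (which is \<infinity> on ereal) does not occur for log E under a Bernoulli law, since
   the positive part of a function taking finitely many values below \<infinity> has
   finite expectation. *)
definition ext_expectation :: "'a measure \<Rightarrow> ('a \<Rightarrow> ereal) \<Rightarrow> ereal" where
  "ext_expectation P Z =
     enn2ereal (\<integral>\<^sup>+ x. e2ennreal (Z x) \<partial>P) - enn2ereal (\<integral>\<^sup>+ x. e2ennreal (- Z x) \<partial>P)"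

definition e_power :: "real measure \<Rightarrow> (real \<Rightarrow> real) \<Rightarrow> ereal" where
  "e_power Q E = ext_expectation Q (\<lambda>x. ext_ln (E x))"

definition is_e_value :: "real measure \<Rightarrow> (real \<Rightarrow> real) \<Rightarrow> bool" where
  "is_e_value P0 E \<longleftrightarrow>
     E \<in> borel_measurable P0 \<and> (\<forall>x. E x \<ge> 0) \<and> (\<integral>\<^sup>+ x. ennreal (E x) \<partial>P0) \<le> 1"

definition best_growth_rate :: "real measure \<Rightarrow> real measure \<Rightarrow> ereal" where
  "best_growth_rate P0 Q = (SUP E \<in> {E. is_e_value P0 E}. e_power Q E)"

definition G :: "real \<Rightarrow> real \<Rightarrow> real measure \<Rightarrow> ereal" where
  "G c m P =
     (let \<mu> = (\<integral>x. x \<partial>P)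
      in ext_expectation P (\<lambda>x. ext_ln (1 + (\<mu> - m) * (x - m) / c)))"

definition f_ratio :: "real \<Rightarrow> real \<Rightarrow> real \<Rightarrow> real" where
  "f_ratio c m \<mu> =
     ln ((1 + (\<mu> - m) * (1 - m) / c) powr \<mu> * (1 - (\<mu> - m) * m / c) powr (1 - \<mu>)) /
     ln ((\<mu> / m) powr \<mu> * ((1 - \<mu>) / (1 - m)) powr (1 - \<mu>))"

end

theory Submission
  imports Defs
begin

text \<open>
  The best \<open>e\<close>-value is the likelihood ratio, whose growth rate is the relative entropy of
  \<open>Bern \<mu>\<close> with respect to \<open>Bern m\<close>. Its optimality, and the positivity of the relative
  entropy that makes the quotient meaningful, both come from \<open>ln x \<le> x - 1\<close> with its equality
  case. The condition \<open>c \<ge> 1/4\<close> keeps the bets positive because \<open>m (1 - m) \<le> 1/4\<close>.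
\<close>

lemma nn_integral_Bern:
  assumes "0 \<le> p" "p \<le> 1"
  shows "(\<integral>\<^sup>+ x. f x \<partial>Bern p) = ennreal p * f 1 + ennreal (1 - p) * f 0"
  using assms by (simp add: Bern_def mult.commute)

lemma integral_Bern:
  fixes f :: "real \<Rightarrow> real"
  assumes "0 \<le> p" "p \<le> 1"
  shows "(\<integral>x. f x \<partial>Bern p) = p * f 1 + (1 - p) * f 0"
  using assms by (simp add: Bern_def mult.commute)

lemma enn2ereal_e2ennreal_max: "enn2ereal (e2ennreal x) = max 0 x"
  by (cases "0 \<le> x") (auto simp: enn2ereal_e2ennreal e2ennreal_neg max_def zero_ennreal.rep_eq)

text \<open>Only the values at 0 and 1 carry mass. Bounding them below \<infinity> makes both
  positive parts finite, so the defining difference is never \<infinity> - \<infinity>, while the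
  value -\<infinity> stays allowed.\<close>

lemma ext_expectation_Bern:
  assumes "0 < p" "p < 1" "Z 1 < \<infinity>" "Z 0 < \<infinity>"
  shows "ext_expectation (Bern p) Z = ereal p * Z 1 + ereal (1 - p) * Z 0"
proof -
  have real: "p * max 0 a + (1 - p) * max 0 b - (p * max 0 (- a) + (1 - p) * max 0 (- b)) =
      p * a + (1 - p) * b" for a b :: real
    by (cases "0 \<le> a"; cases "0 \<le> b") (simp_all add: max_def)
  have "ext_expectation (Bern p) Z =
      (ereal p * max 0 (Z 1) + ereal (1 - p) * max 0 (Z 0)) -
      (ereal p * max 0 (- Z 1) + ereal (1 - p) * max 0 (- Z 0))"
    using assms
    by (simp add: ext_expectation_def nn_integral_Bern plus_ennreal.rep_eq times_ennreal.rep_eq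
        enn2ereal_ennreal enn2ereal_e2ennreal_max)
  also have "\<dots> = ereal p * Z 1 + ereal (1 - p) * Z 0"
    using assms
  \<comment> \<open>Real values reduce to z = max 0 z - max 0 (-z); if one value is -\<infinity>,
    both sides are -\<infinity>.\<close>
  proof (cases "Z 1"; cases "Z 0")
    fix a b assume Z: "Z 1 = ereal a" "Z 0 = ereal b"
    have max: "max 0 (ereal r) = ereal (max 0 r)" for r
      by (simp add: zero_ereal_def)
    show ?thesis
      unfolding Z uminus_ereal.simps max times_ereal.simps plus_ereal.simps ereal_minus(1)
      using real by simp
  qed (simp_all add: max_def)
  finally show ?thesis .
qed

lemma ext_ln_less_infinity [simp]: "ext_ln y < \<infinity>"
  by (simp add: ext_ln_def)

lemma ext_expectation_ext_ln_Bern: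
  assumes "0 < p" "p < 1" "0 < E 1" "0 < E 0"
  shows "ext_expectation (Bern p) (\<lambda>x. ext_ln (E x)) = ereal (p * ln (E 1) + (1 - p) * ln (E 0))"
  using assms by (simp add: ext_expectation_Bern ext_ln_def)

text \<open>Both outcomes have positive mass, so losing everything on one of them cannot be offset
  by the finite logarithm on the other.\<close>

lemma e_power_Bern_eq_minus_infinity:
  assumes "0 < p" "p < 1" "E 1 \<le> 0 \<or> E 0 \<le> 0"
  shows "e_power (Bern p) E = -\<infinity>"
  using assms by (auto simp: e_power_def ext_expectation_Bern ext_ln_def)

lemma is_e_value_Bern_iff:
  assumes "0 \<le> m" "m \<le> 1"
  shows "is_e_value (Bern m) E \<longleftrightarrow> (\<forall>x. 0 \<le> E x) \<and> m * E 1 + (1 - m) * E 0 \<le> 1"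
  using assms
  by (auto simp: is_e_value_def nn_integral_Bern ennreal_mult[symmetric] ennreal_plus[symmetric]
      simp del: ennreal_plus)

text \<open>This is \<open>ln t \<le> t - 1\<close> at t = q / p, scaled by p. Since p and q are
  arbitrary positive weights, it also applies to weights whose total is below 1.\<close>

lemma ln_ratio_ge:
  fixes p q :: real
  assumes "0 < p" "0 < q"
  shows "p - q \<le> p * ln (p / q)"
proof -
  have "p * ln (q / p) \<le> p * (q / p - 1)"
    using assms by (intro mult_left_mono ln_le_minus_one) auto
  then show ?thesis
    using assms by (simp add: ln_div algebra_simps)
qed

lemma ln_ratio_gt:
  fixes p q :: real
  assumes "0 < p" "0 < q" "p \<noteq> q"
  shows "p - q < p * ln (p / q)"
proof -
  have "ln (q / p) \<noteq> q / p - 1"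
    using assms ln_eq_minus_one[of "q / p"] by auto
  then have "ln (q / p) < q / p - 1"
    using assms ln_le_minus_one[of "q / p"] by fastforce
  then have "p * ln (q / p) < p * (q / p - 1)"
    using assms by simp
  then show ?thesis
    using assms by (simp add: ln_div algebra_simps)
qed

definition KL_Bern :: "real \<Rightarrow> real \<Rightarrow> real" where
  "KL_Bern \<mu> m = \<mu> * ln (\<mu> / m) + (1 - \<mu>) * ln ((1 - \<mu>) / (1 - m))"

text \<open>The lower bounds for the two outcomes sum to 0, and strictness in one of them
  suffices.\<close>

lemma KL_Bern_pos:
  assumes "0 < \<mu>" "\<mu> < 1" "0 < m" "m < 1" "m \<noteq> \<mu>"
  shows "0 < KL_Bern \<mu> m"
  using ln_ratio_gt[of \<mu> m] ln_ratio_ge[of "1 - \<mu>" "1 - m"] assms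
  by (simp add: KL_Bern_def)

text \<open>An e-value turns the null weights into m * a and (1 - m) * b, of total at most 1.
  Comparing \<mu> and 1 - \<mu> with these bounds the gap between the two sides below by 1 - (m * a
  + (1 - m) * b).\<close>

lemma expected_ln_le_KL_Bern:
  assumes "0 < \<mu>" "\<mu> < 1" "0 < m" "m < 1" "0 < a" "0 < b" "m * a + (1 - m) * b \<le> 1"
  shows "\<mu> * ln a + (1 - \<mu>) * ln b \<le> KL_Bern \<mu> m"
proof -
  have "ln (\<mu> / (m * a)) = ln (\<mu> / m) - ln a"
    "ln ((1 - \<mu>) / ((1 - m) * b)) = ln ((1 - \<mu>) / (1 - m)) - ln b"
    using assms by (simp_all add: ln_div ln_mult)
  then show ?thesis
    using ln_ratio_ge[of \<mu> "m * a"] ln_ratio_ge[of "1 - \<mu>" "(1 - m) * b"] assms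
    by (simp add: KL_Bern_def right_diff_distrib)
qed

lemma best_growth_rate_Bern:
  assumes "0 < \<mu>" "\<mu> < 1" "0 < m" "m < 1"
  shows "best_growth_rate (Bern m) (Bern \<mu>) = ereal (KL_Bern \<mu> m)"
  unfolding best_growth_rate_def
proof (rule SUP_eqI)
  fix E assume "E \<in> {E. is_e_value (Bern m) E}"
  then have E: "m * E 1 + (1 - m) * E 0 \<le> 1"
    using assms by (simp add: is_e_value_Bern_iff)
  show "e_power (Bern \<mu>) E \<le> ereal (KL_Bern \<mu> m)"
  proof (cases "0 < E 1 \<and> 0 < E 0")
    case True
    then show ?thesis
      using assms E expected_ln_le_KL_Bern[of \<mu> m "E 1" "E 0"]
      by (simp add: e_power_def ext_expectation_ext_ln_Bern)
  next
    case False
    then have "E 1 \<le> 0 \<or> E 0 \<le> 0" by auto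
    then show ?thesis
      using assms by (simp add: e_power_Bern_eq_minus_infinity)
  qed
next
  fix y assume y: "\<And>E. E \<in> {E. is_e_value (Bern m) E} \<Longrightarrow> e_power (Bern \<mu>) E \<le> y"
  \<comment> \<open>The likelihood ratio; its value off {0, 1} only has to be nonnegative.\<close>
  define L where "L x = (if x = 1 then \<mu> / m else (1 - \<mu>) / (1 - m))" for x :: real
  have "is_e_value (Bern m) L"
    using assms by (simp add: is_e_value_Bern_iff L_def)
  moreover have "e_power (Bern \<mu>) L = ereal (KL_Bern \<mu> m)"
    using assms by (simp add: e_power_def ext_expectation_ext_ln_Bern L_def KL_Bern_def)
  ultimately show "ereal (KL_Bern \<mu> m) \<le> y"
    using y[of L] by simp
qed

lemma bet_pos:
  fixes c m \<mu> :: real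
  assumes "c \<ge> 1/4" "0 < \<mu>" "\<mu> < 1" "0 < m" "m < 1"
  shows "0 < 1 + (\<mu> - m) * (1 - m) / c" "0 < 1 - (\<mu> - m) * m / c"
proof -
  have "0 \<le> (m - 1/2)\<^sup>2" by simp
  then have var: "m * (1 - m) \<le> c"
    using assms by (simp add: power2_eq_square algebra_simps)
  \<comment> \<open>The extreme cases \<mu> = 0 and \<mu> = 1 both give the loss m * (1 - m), which
    is at most 1/4.\<close>
  have "(m - \<mu>) * (1 - m) < m * (1 - m)" "(\<mu> - m) * m < (1 - m) * m"
    using assms by auto
  with var have "0 < c + (\<mu> - m) * (1 - m)" "0 < c - (\<mu> - m) * m"
    by (simp_all add: algebra_simps)
  then show "0 < 1 + (\<mu> - m) * (1 - m) / c" "0 < 1 - (\<mu> - m) * m / c"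
    using assms by (simp_all add: field_simps)
qed

lemma ln_powr_mult_powr:
  fixes a b p q :: real
  assumes "0 < a" "0 < b"
  shows "ln (a powr p * b powr q) = p * ln a + q * ln b"
  using assms by (simp add: ln_mult ln_powr)

theorem lemma3:
  fixes c m \<mu> :: real
  assumes "c \<ge> 1/4"
    and "0 < \<mu>" and "\<mu> < 1"
    and "0 < m" and "m < 1"
    and "m \<noteq> \<mu>"
  shows "G c m (Bern \<mu>) / best_growth_rate (Bern m) (Bern \<mu>) = ereal (f_ratio c m \<mu>)"
proof -
  let ?a = "1 + (\<mu> - m) * (1 - m) / c" and ?b = "1 - (\<mu> - m) * m / c"
  have pos: "0 < ?a" "0 < ?b"
    using bet_pos assms by blast+
  have "G c m (Bern \<mu>) = ext_expectation (Bern \<mu>) (\<lambda>x. ext_ln (1 + (\<mu> - m) * (x - m) / c))"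
    using assms by (simp add: G_def integral_Bern)
  also have "\<dots> = ereal (\<mu> * ln ?a + (1 - \<mu>) * ln ?b)"
    using assms pos by (subst ext_expectation_ext_ln_Bern) simp_all
  also have "\<mu> * ln ?a + (1 - \<mu>) * ln ?b = ln (?a powr \<mu> * ?b powr (1 - \<mu>))"
    using pos by (simp only: ln_powr_mult_powr)
  finally have "G c m (Bern \<mu>) = ereal (ln (?a powr \<mu> * ?b powr (1 - \<mu>)))" .
  moreover have "KL_Bern \<mu> m = ln ((\<mu> / m) powr \<mu> * ((1 - \<mu>) / (1 - m)) powr (1 - \<mu>))"
    using assms by (simp add: KL_Bern_def ln_powr_mult_powr)
  \<comment> \<open>A nonzero denominator makes the division of extended reals agree with that of
    reals.\<close>
  ultimately show ?thesis
    using assms KL_Bern_pos[of \<mu> m] by (simp add: best_growth_rate_Bern f_ratio_def)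
qed

end
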